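(* For every irrational $\alpha$, there are infinitely many positive integers $n$ such that $\operatorname{ord}(\pi_{\alpha,n})<n$.
   Context: $\{x\}$ denotes the fractional part of a real number $x$. For $\alpha$ irrational and $n$ a positive integer, $\pi_{\alpha,n}$ is the permutation of $\{1,2,\dots,n\}$ that orders the fractional parts $\{\alpha\},\{2\alpha\},\dots,\{n\alpha\}$, i.e. the unique permutation with $0<\{\pi_{\alpha,n}(1)\alpha\}<\{\pi_{\alpha,n}(2)\alpha\}<\dots<\{\pi_{\alpha,n}(n)\alpha\}<1$. For a permutation $\sigma$ in the symmetric group $S_n$, $\operatorname{ord}(\sigma)$ is the least positive integer $t$ such that $\sigma^t$ is the identity. *)

theory Defs
  imports Complex_Main "HOL-Algebra.Sym_Groups" "HOL-Algebra.Multiplicative_Group"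
begin

text \<open>
  A permutation of \<open>{1..n}\<close> is a function \<open>p :: nat \<Rightarrow> nat\<close> with \<open>p permutes {1..n}\<close>, hence the
  identity outside \<open>{1..n}\<close>.  These are the elements of the library's \<open>sym_group n\<close>.
\<close>

definition orders_frac_parts :: "real \<Rightarrow> nat \<Rightarrow> (nat \<Rightarrow> nat) \<Rightarrow> bool" where
  "orders_frac_parts \<alpha> n p \<longleftrightarrow>
     p permutes {1..n} \<and>
     (\<forall>i\<in>{1..n}. 0 < frac (real (p i) * \<alpha>) \<and> frac (real (p i) * \<alpha>) < 1) \<and>
     (\<forall>i\<in>{1..n}. \<forall>j\<in>{1..n}. i < j \<longrightarrow> frac (real (p i) * \<alpha>) < frac (real (p j) * \<alpha>))"

text \<open>Meaningful for irrational \<open>\<alpha>\<close> only; see \<open>ex1_orders_frac_parts\<close>.\<close>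

definition frac_perm :: "real \<Rightarrow> nat \<Rightarrow> (nat \<Rightarrow> nat)" where
  "frac_perm \<alpha> n = (THE p. orders_frac_parts \<alpha> n p)"

lemma frac_mult_irrational_inj:
  assumes "\<alpha> \<notin> \<rat>"
  shows "inj (\<lambda>k::nat. frac (real k * \<alpha>))"
proof (rule injI, rule ccontr)
  fix j k :: nat
  assume eq: "frac (real j * \<alpha>) = frac (real k * \<alpha>)" and "j \<noteq> k"
  then have "(real j - real k) * \<alpha> = of_int (\<lfloor>real j * \<alpha>\<rfloor> - \<lfloor>real k * \<alpha>\<rfloor>)"
    by (simp add: frac_def algebra_simps)
  with \<open>j \<noteq> k\<close> have "\<alpha> = of_int (\<lfloor>real j * \<alpha>\<rfloor> - \<lfloor>real k * \<alpha>\<rfloor>) / (real j - real k)"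
    by (simp add: field_simps)
  moreover have "of_int (\<lfloor>real j * \<alpha>\<rfloor> - \<lfloor>real k * \<alpha>\<rfloor>) / (real j - real k) \<in> \<rat>"
    by (intro Rats_divide Rats_diff Rats_of_int Rats_of_nat)
  ultimately show False using assms by simp
qed

lemma frac_mult_irrational_pos:
  assumes "\<alpha> \<notin> \<rat>" "k \<ge> 1"
  shows "0 < frac (real k * \<alpha>)"
  using frac_mult_irrational_inj[OF assms(1), THEN injD, of k 0] assms(2)
    frac_ge_0[of "real k * \<alpha>"] by (fastforce simp: less_le)

lemma ex1_orders_frac_parts:
  assumes irr: "\<alpha> \<notin> \<rat>"
  shows "\<exists>!p. orders_frac_parts \<alpha> n p"
proof (rule ex_ex1I)
  let ?f = "\<lambda>k::nat. frac (real k * \<alpha>)"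
  note inj = frac_mult_irrational_inj[OF irr]
  define xs where "xs = sort_key ?f [1..<Suc n]"
  have xs: "set xs = {1..n}" "distinct xs" "length xs = n" "sorted (map ?f xs)"
    unfolding xs_def by auto
  have mono: "?f (xs ! i) < ?f (xs ! j)" if "i < j" "j < n" for i j
  proof -
    have "?f (xs ! i) \<le> ?f (xs ! j)"
      using sorted_nth_mono[OF xs(4), of i j] that xs(3) by simp
    moreover have "xs ! i \<noteq> xs ! j"
      using that xs by (simp add: nth_eq_iff_index_eq)
    ultimately show ?thesis
      using injD[OF inj, of "xs ! i" "xs ! j"] by linarith
  qed
  define p where "p = (\<lambda>i. if i \<in> {1..n} then xs ! (i - 1) else i)"
  have "bij_betw (\<lambda>i. xs ! (i - 1)) {1..n} {1..n}"
  proof (rule bij_betw_trans[of "\<lambda>i. i - 1" _ "{..<n}" "\<lambda>i. xs ! i", unfolded comp_def])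
    show "bij_betw (\<lambda>i. i - 1) {1..n} {..<n}"
      by (rule bij_betwI[where g = Suc]) auto
    show "bij_betw (\<lambda>i. xs ! i) {..<n} {1..n}"
      using bij_betw_nth[OF xs(2)] xs(1,3) by simp
  qed
  then have "bij_betw p {1..n} {1..n}"
    by (rule bij_betw_cong[THEN iffD1, rotated]) (simp add: p_def)
  then have perm: "p permutes {1..n}"
    by (rule bij_imp_permutes) (simp only: p_def if_False)
  have "orders_frac_parts \<alpha> n p"
    unfolding orders_frac_parts_def
  proof (intro conjI ballI impI)
    show "p permutes {1..n}" by (fact perm)
    fix i assume i: "i \<in> {1..n}"
    then have "p i \<ge> 1" using permutes_in_image[OF perm, of i] by simp
    then show "0 < ?f (p i)" by (rule frac_mult_irrational_pos[OF irr])
    show "?f (p i) < 1" by (rule frac_lt_1)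
    fix j assume "j \<in> {1..n}" "i < j"
    then show "?f (p i) < ?f (p j)" using i mono[of "i - 1" "j - 1"] by (simp add: p_def)
  qed
  then show "\<exists>p. orders_frac_parts \<alpha> n p" by blast
next
  fix p q
  let ?f = "\<lambda>k::nat. frac (real k * \<alpha>)"
  assume pq: "orders_frac_parts \<alpha> n p" "orders_frac_parts \<alpha> n q"
  have *: "sorted (map ?f (map r [1..<Suc n]))" "distinct (map ?f (map r [1..<Suc n]))"
      "set (map r [1..<Suc n]) = {1..n}" "r permutes {1..n}"
    if "orders_frac_parts \<alpha> n r" for r
  proof -
    show perm: "r permutes {1..n}" using that by (simp add: orders_frac_parts_def)
    have mono: "?f (r (Suc i)) < ?f (r (Suc j))" if "i < j" "j < n" for i j
      using \<open>orders_frac_parts \<alpha> n r\<close> that by (simp add: orders_frac_parts_def)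
    have "sorted_wrt (<) (map ?f (map r [1..<Suc n]))"
      by (subst sorted_wrt_iff_nth_less) (auto simp del: upt_Suc simp: mono)
    then show "sorted (map ?f (map r [1..<Suc n]))" "distinct (map ?f (map r [1..<Suc n]))"
      unfolding strict_sorted_iff by blast+
    have "set (map r [1..<Suc n]) = r ` {1..n}"
      by (simp only: set_map set_upt atLeastLessThanSuc_atLeastAtMost)
    then show "set (map r [1..<Suc n]) = {1..n}"
      using permutes_image[OF perm] by simp
  qed
  have "map p [1..<Suc n] = map q [1..<Suc n]"
    by (rule map_sorted_distinct_set_unique[of ?f])
      (use *[OF pq(1)] *[OF pq(2)] inj_on_subset[OF frac_mult_irrational_inj[OF irr]] in \<open>simp_all del: upt_Suc\<close>)
  then have eq: "p i = q i" if "i \<in> {1..n}" for i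
    using that by (auto simp del: upt_Suc)
  show "p = q"
  proof
    fix i show "p i = q i"
      using eq[of i] *(4)[OF pq(1)] *(4)[OF pq(2)] by (cases "i \<in> {1..n}") (simp_all add: permutes_not_in)
  qed
qed

lemma orders_frac_parts_frac_perm:
  assumes "\<alpha> \<notin> \<rat>"
  shows "orders_frac_parts \<alpha> n (frac_perm \<alpha> n)"
  unfolding frac_perm_def by (rule theI'[OF ex1_orders_frac_parts[OF assms]])

text \<open>
  The library defines \<open>group.ord\<close> by divisibility; on \<open>sym_group n\<close> it is the least positive
  \<open>t\<close> such that the \<open>t\<close>-fold iterate is the identity.
\<close>

lemma sym_group_ord_eq_Least:
  assumes p: "p permutes {1..n}"
  shows "group.ord (sym_group n) p = (LEAST t. 0 < t \<and> p ^^ t = id)"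
proof -
  interpret group "sym_group n" by (rule sym_group_is_group)
  have pc: "p \<in> carrier (sym_group n)" using p by (simp add: sym_group_carrier)
  have pow: "p [^]\<^bsub>sym_group n\<^esub> t = p ^^ t" for t :: nat
    by (induction t) (simp_all add: sym_group_one sym_group_mult funpow_swap1 fun_eq_iff)
  have dvd: "p ^^ t = id \<longleftrightarrow> ord p dvd t" for t
    using pow_eq_id[OF pc, of t] by (simp add: pow sym_group_one)
  have "finite (carrier (sym_group n))"
    by (simp add: sym_group_def finite_permutations)
  then have "ord p \<ge> 1" using ord_ge_1 pc by blast
  then show ?thesis
    by (intro Least_equality[symmetric]) (auto simp: dvd dvd_imp_le)
qed

end

theory Submission
  imports Defs "HOL-Number_Theory.Residues"
begin

text \<open>
  The idea is to choose \<open>n = q\<close> for a fraction \<open>p/q\<close> in lowest terms that lies above \<open>\<alpha>\<close> and is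
  so close to it that \<open>0 < p/q - \<alpha> < 1/q\<^sup>2\<close>.  For \<open>1 \<le> k \<le> q\<close>, passing from \<open>k p/q\<close> to
  \<open>k \<alpha>\<close> then moves the number down by less than \<open>1/q\<close>.  So if \<open>r\<close> is the representative of
  \<open>k p\<close> modulo \<open>q\<close> in \<open>{1..q}\<close>, the fractional part of \<open>k \<alpha>\<close> lies strictly between
  \<open>(r - 1)/q\<close> and \<open>r/q\<close> (\<open>frac_between_multiples\<close>).  Since distinct \<open>k\<close> have distinct \<open>r\<close>, the
  rank of the fractional part of \<open>k \<alpha>\<close> is exactly \<open>r\<close>, that is, the ordering permutation is the
  inverse of multiplication by \<open>p\<close> modulo \<open>q\<close> (\<open>frac_perm_eq_inv_mult_perm\<close>).  By Euler's theorem
  its order is at most \<open>totient q\<close>, which is less than \<open>q\<close> for \<open>q \<ge> 2\<close>.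

  Approximating from above matters: it sends the index \<open>q\<close> itself to the last rank, where it
  is the fixed point \<open>q \<equiv> 0\<close> of the multiplication.  From below, index \<open>q\<close> would come first and
  the permutation would be the inverse of the affine map \<open>k \<mapsto> k p + 1\<close> instead.

  That there are such fractions with arbitrarily large \<open>q\<close> follows from Farey neighbours
  \<open>a/b < \<alpha> < c/d\<close> with \<open>c b - a d = 1\<close>.  The Euclidean algorithm on the two distances
  \<open>b \<alpha> - a\<close> and \<open>c - d \<alpha>\<close> never stops since \<open>\<alpha>\<close> is irrational, and it can be arranged to return
  infinitely often to a state in which the upper distance is the smaller one; there \<open>c/d\<close> is
  as close as required (\<open>farey_neighbours\<close>, \<open>good_approximation_from_above\<close>).
\<close>

section \<open>Good rational approximations from above\<close>

lemma pos_remainder_exists: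
  fixes x y :: real
  assumes "0 < x" "0 < y" and ne: "\<And>k :: nat. y \<noteq> real k * x"
  obtains k :: nat where "0 < y - real k * x" "y - real k * x < x"
proof
  let ?k = "nat \<lfloor>y / x\<rfloor>"
  have k: "real ?k = of_int \<lfloor>y / x\<rfloor>" using assms by simp
  have "real ?k \<le> y / x" "y / x < real ?k + 1" unfolding k by linarith+
  then have "real ?k * x \<le> y" "y < (real ?k + 1) * x"
    using \<open>0 < x\<close> by (simp_all only: pos_le_divide_eq pos_divide_less_eq)
  then show "0 < y - real ?k * x" "y - real ?k * x < x"
    using ne[of ?k] by (auto simp: algebra_simps)
qed

lemma irrational_linear_nonzero:
  fixes \<alpha> :: real and b c :: int
  assumes "\<alpha> \<notin> \<rat>" "0 < b"
  shows "of_int b * \<alpha> \<noteq> of_int c"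
proof
  assume "of_int b * \<alpha> = of_int c"
  then have "\<alpha> = of_int c / of_int b" using assms by (simp add: field_simps)
  then show False using assms by auto
qed

text \<open>
  Induction along the Euclidean algorithm.  Write \<open>x = b \<alpha> - a\<close> and \<open>y = c - d \<alpha>\<close>; subtracting a
  multiple of \<open>y\<close> from \<open>x\<close> replaces \<open>a/b\<close> by an iterated mediant of \<open>a/b\<close> and \<open>c/d\<close>, and
  symmetrically for \<open>y\<close>; both keep the determinant.  Two such reductions lead from one state
  with \<open>y < x\<close> to the next, and the second one increases \<open>d\<close>.
\<close>
lemma farey_neighbours:
  fixes \<alpha> :: real and N :: nat
  assumes irr: "\<alpha> \<notin> \<rat>"
  shows "\<exists>a b c d :: int. 0 < b \<and> 0 < d \<and> int N \<le> d \<and> c * b - a * d = 1 \<and>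
    0 < of_int c - of_int d * \<alpha> \<and> of_int c - of_int d * \<alpha> < of_int b * \<alpha> - of_int a"
proof (induction N)
  case 0
  \<comment> \<open>Reduce the neighbours \<open>a\<close> and \<open>a + 1\<close>, both of denominator 1, once on the upper side.\<close>
  define a where "a = \<lfloor>\<alpha>\<rfloor>"
  have "of_int a \<noteq> \<alpha>" using irrational_linear_nonzero[OF irr, of 1 a] by simp
  then have x: "0 < \<alpha> - of_int a" and y: "0 < of_int a + 1 - \<alpha>"
    unfolding a_def by linarith+
  have "of_int a + 1 - \<alpha> \<noteq> real k * (\<alpha> - of_int a)" for k
    using irrational_linear_nonzero[OF irr, of "1 + int k" "(a + 1) + int k * a"]
    by (auto simp: algebra_simps)
  then obtain k where "0 < of_int a + 1 - \<alpha> - real k * (\<alpha> - of_int a)"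
    "of_int a + 1 - \<alpha> - real k * (\<alpha> - of_int a) < \<alpha> - of_int a"
    using pos_remainder_exists[OF x y] by blast
  then show ?case
    by (intro exI[of _ a] exI[of _ 1] exI[of _ "a + 1 + int k * a"] exI[of _ "1 + int k"])
      (auto simp: algebra_simps)
next
  case (Suc N)
  then obtain a b c d :: int where bd: "0 < b" "0 < d" "int N \<le> d" and det: "c * b - a * d = 1"
    and y: "0 < of_int c - of_int d * \<alpha>"
    and yx: "of_int c - of_int d * \<alpha> < of_int b * \<alpha> - of_int a"
    by blast
  from y yx have x: "0 < of_int b * \<alpha> - of_int a" by linarith
  have "of_int b * \<alpha> - of_int a \<noteq> real k * (of_int c - of_int d * \<alpha>)" for k
    using irrational_linear_nonzero[OF irr, of "b + int k * d" "a + int k * c"] bd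
    by (auto simp: algebra_simps add_pos_nonneg)
  then obtain k where k: "0 < of_int b * \<alpha> - of_int a - real k * (of_int c - of_int d * \<alpha>)"
    "of_int b * \<alpha> - of_int a - real k * (of_int c - of_int d * \<alpha>) < of_int c - of_int d * \<alpha>"
    using pos_remainder_exists[OF y x] by blast
  define a' b' where "a' = a + int k * c" and "b' = b + int k * d"
  have b': "0 < b'" unfolding b'_def using bd by (simp add: add_pos_nonneg)
  have det': "c * b' - a' * d = 1" using det unfolding a'_def b'_def by (simp add: algebra_simps)
  have x': "0 < of_int b' * \<alpha> - of_int a'"
    and x'y: "of_int b' * \<alpha> - of_int a' < of_int c - of_int d * \<alpha>"
    using k unfolding a'_def b'_def by (simp_all add: algebra_simps)
  have "of_int c - of_int d * \<alpha> \<noteq> real m * (of_int b' * \<alpha> - of_int a')" for m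
    using irrational_linear_nonzero[OF irr, of "d + int m * b'" "c + int m * a'"] bd b'
    by (auto simp: algebra_simps add_pos_nonneg)
  then obtain m where m: "0 < of_int c - of_int d * \<alpha> - real m * (of_int b' * \<alpha> - of_int a')"
    "of_int c - of_int d * \<alpha> - real m * (of_int b' * \<alpha> - of_int a') < of_int b' * \<alpha> - of_int a'"
    using pos_remainder_exists[OF x' y] by blast
  \<comment> \<open>The first reduction left a remainder below the upper distance, so the second
    reduction is not void and the upper denominator grows.\<close>
  have "m \<noteq> 0" using m(2) x'y by (intro notI) simp
  then have "1 * 1 \<le> int m * b'" using b' by (intro mult_mono) auto
  then have d': "0 < d + int m * b'" "int (Suc N) \<le> d + int m * b'" using bd by simp_all
  have "(c + int m * a') * b' - a' * (d + int m * b') = 1"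
    using det' by (simp add: algebra_simps)
  with b' d' m show ?case
    by (intro exI[of _ a'] exI[of _ b'] exI[of _ "c + int m * a'"] exI[of _ "d + int m * b'"])
      (simp add: algebra_simps)
qed

text \<open>
  For Farey neighbours the determinant condition reads \<open>b y + d x = 1\<close>, where
  \<open>x = b \<alpha> - a\<close> and \<open>y = c - d \<alpha>\<close>, so \<open>y < x\<close> forces \<open>d y < 1\<close>; it also makes \<open>c\<close> and
  \<open>d\<close> coprime.
\<close>
lemma good_approximation_from_above:
  fixes \<alpha> :: real and N :: nat
  assumes irr: "\<alpha> \<notin> \<rat>"
  obtains p :: int and q :: nat where "0 < q" "N \<le> q" "coprime p (int q)"
    "0 < of_int p - real q * \<alpha>" "real q * (of_int p - real q * \<alpha>) < 1"
proof -
  obtain a b c d :: int where bd: "0 < b" "0 < d" "int N \<le> d" and det: "c * b - a * d = 1"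
    and y: "0 < of_int c - of_int d * \<alpha>"
    and yx: "of_int c - of_int d * \<alpha> < of_int b * \<alpha> - of_int a"
    using farey_neighbours[OF irr, of N] by blast
  define y where "y = of_int c - of_int d * \<alpha>"
  define x where "x = of_int b * \<alpha> - of_int a"
  have "of_int d * y \<le> of_int d * x" using yx bd unfolding x_def y_def by simp
  also have "of_int d * x = of_int (c * b - a * d) - of_int b * y"
    unfolding x_def y_def by (simp add: algebra_simps)
  also have "\<dots> < 1" using bd y unfolding det y_def by simp
  finally have "of_int d * y < 1" .
  moreover have "coprime c d"
  proof (rule coprimeI)
    fix g assume "g dvd c" "g dvd d"
    then have "g dvd c * b - a * d" by simp
    then show "is_unit g" unfolding det .
  qed
  ultimately show ?thesis
    using that[of "nat d" c] bd y unfolding y_def by simp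
qed

section \<open>Multiplication modulo q as a permutation\<close>

text \<open>
  Multiplication by \<open>p\<close> modulo \<open>q\<close>.  Subtracting and adding 1 around \<open>mod\<close> selects
  representatives in \<open>{1..q}\<close> rather than \<open>{0..<q}\<close>, so that they can serve as ranks.  The multiplier
  is an integer since \<open>\<alpha>\<close>, and with it the numerator of an approximation, may be negative.
\<close>
definition mult_perm :: "int \<Rightarrow> nat \<Rightarrow> nat \<Rightarrow> nat" where
  "mult_perm p q k = (if k \<in> {1..q} then nat ((int k * p - 1) mod int q) + 1 else k)"

lemma mult_perm_range:
  assumes "k \<in> {1..q}"
  shows "mult_perm p q k \<in> {1..q}"
proof -
  have "0 < int q" using assms by simp
  then have "nat ((int k * p - 1) mod int q) < q"
    using pos_mod_bound[of "int q" "int k * p - 1"] by (simp add: nat_less_iff)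
  then show ?thesis using assms by (simp add: mult_perm_def)
qed

lemma mult_perm_cong:
  assumes "k \<in> {1..q}"
  shows "[int (mult_perm p q k) = int k * p] (mod int q)"
proof -
  have "int (mult_perm p q k) = (int k * p - 1) mod int q + 1"
    using assms by (simp add: mult_perm_def)
  moreover have "[(int k * p - 1) mod int q + 1 = (int k * p - 1) + 1] (mod int q)"
    by (intro cong_add) (simp_all add: cong_def)
  ultimately show ?thesis by simp
qed

lemma eq_of_cong_in_range:
  fixes j k q :: nat
  assumes "j \<in> {1..q}" "k \<in> {1..q}" "[int j = int k] (mod int q)"
  shows "j = k"
proof -
  have "[int j - 1 = int k - 1] (mod int q)" using assms(3) by (intro cong_diff) simp_all
  then have "int j - 1 = int k - 1" using assms(1,2) by (intro cong_less_imp_eq_int) auto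
  then show ?thesis by simp
qed

lemma mult_perm_permutes:
  assumes "coprime p (int q)"
  shows "mult_perm p q permutes {1..q}"
proof (rule bij_imp_permutes)
  have "inj_on (mult_perm p q) {1..q}"
  proof (rule inj_onI)
    fix j k assume jk: "j \<in> {1..q}" "k \<in> {1..q}" "mult_perm p q j = mult_perm p q k"
    then have "[int j * p = int k * p] (mod int q)"
      using mult_perm_cong[of j q p] mult_perm_cong[of k q p] by (metis cong_sym cong_trans)
    then show "j = k"
      using jk eq_of_cong_in_range assms cong_mult_rcancel by blast
  qed
  moreover have "mult_perm p q ` {1..q} \<subseteq> {1..q}" using mult_perm_range by blast
  ultimately show "bij_betw (mult_perm p q) {1..q} {1..q}"
    by (simp add: bij_betw_def endo_inj_surj)
qed (auto simp: mult_perm_def)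

lemma funpow_mult_perm:
  assumes "k \<in> {1..q}"
  shows "(mult_perm p q ^^ t) k \<in> {1..q} \<and>
    [int ((mult_perm p q ^^ t) k) = int k * p ^ t] (mod int q)"
proof (induction t)
  case 0
  then show ?case using assms by simp
next
  case (Suc t)
  let ?j = "(mult_perm p q ^^ t) k"
  have "[int (mult_perm p q ?j) = int ?j * p] (mod int q)"
    using Suc mult_perm_cong by blast
  also have "[int ?j * p = int k * p ^ t * p] (mod int q)"
    using Suc by (intro cong_mult) simp_all
  finally show ?case using Suc mult_perm_range by (simp add: mult_ac)
qed

lemma euler_theorem_int:
  fixes p :: int and q :: nat
  assumes "coprime p (int q)"
  shows "[p ^ totient q = 1] (mod int q)"
proof (cases "q \<le> 1")
  case True
  then have "q = 0 \<or> q = 1" by linarith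
  then show ?thesis by auto
next
  case False
  then interpret residues "int q" "residue_ring (int q)" by unfold_locales simp_all
  show ?thesis using euler_theorem[OF assms] by simp
qed

text \<open>By Euler's theorem; agreement modulo \<open>q\<close> is equality because the values stay in
  \<open>{1..q}\<close>.\<close>
lemma funpow_totient_mult_perm:
  assumes "coprime p (int q)"
  shows "mult_perm p q ^^ totient q = id"
proof
  fix k
  show "(mult_perm p q ^^ totient q) k = id k"
  proof (cases "k \<in> {1..q}")
    case True
    let ?j = "(mult_perm p q ^^ totient q) k"
    have j: "?j \<in> {1..q}" "[int ?j = int k * p ^ totient q] (mod int q)"
      using funpow_mult_perm[OF True] by blast+
    note j(2)
    also have "[int k * p ^ totient q = int k * 1] (mod int q)"
      using assms by (intro cong_mult euler_theorem_int) simp_all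
    finally show ?thesis using eq_of_cong_in_range[OF j(1) True] by simp
  next
    case False
    then have "(mult_perm p q ^^ t) k = k" for t
      by (induction t) (auto simp: mult_perm_def)
    then show ?thesis by simp
  qed
qed

section \<open>The ordering permutation and its order\<close>

text \<open>
  Put \<open>e = p - q \<alpha>\<close> and write \<open>k p = r + q m\<close> with \<open>r\<close> in \<open>{1..q}\<close>.  Then
  \<open>q (k \<alpha> - m) = r - k e\<close>, and \<open>0 < k e \<le> q e < 1\<close>.
\<close>
lemma frac_between_multiples:
  fixes \<alpha> :: real
  assumes pos: "0 < of_int p - real q * \<alpha>" and small: "real q * (of_int p - real q * \<alpha>) < 1"
    and k: "k \<in> {1..q}"
  shows "real (mult_perm p q k) - 1 < real q * frac (real k * \<alpha>)"
    and "real q * frac (real k * \<alpha>) < real (mult_perm p q k)"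
proof -
  define r where "r = mult_perm p q k"
  define e where "e = of_int p - real q * \<alpha>"
  have q: "0 < real q" using k by simp
  have r: "1 \<le> r" "r \<le> q" using mult_perm_range[OF k, of p] by (simp_all add: r_def)
  obtain m where m: "int k * p = int r + int q * m"
    using mult_perm_cong[OF k, of p] by (metis cong_iff_lin cong_sym r_def)
  have "0 < real k * e" "real k * e \<le> real q * e"
    using k pos by (simp_all add: e_def)
  then have ke: "0 < real k * e" "real k * e < 1" using small unfolding e_def by linarith+
  have "real q * (real k * \<alpha>) = of_int (int k * p) - real k * e"
    by (simp add: e_def algebra_simps)
  then have eq: "real q * (real k * \<alpha> - of_int m) = real r - real k * e"
    unfolding m by (simp add: algebra_simps)
  have "0 < real q * (real k * \<alpha> - of_int m)" "real q * (real k * \<alpha> - of_int m) < real q * 1"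
    using ke r unfolding eq by linarith+
  then have "0 \<le> real k * \<alpha> - of_int m" "real k * \<alpha> - of_int m < 1"
    using q by (simp_all add: zero_less_mult_iff)
  then have "frac (real k * \<alpha>) = real k * \<alpha> - of_int m"
    by (simp add: frac_unique_iff)
  then show "real (mult_perm p q k) - 1 < real q * frac (real k * \<alpha>)"
    "real q * frac (real k * \<alpha>) < real (mult_perm p q k)"
    using eq ke by (simp_all add: r_def)
qed

text \<open>
  Multiplication by \<open>p\<close> gives the rank of each index, whereas \<open>frac_perm\<close> gives the index of each
  rank, hence the inverse.
\<close>
lemma frac_perm_eq_inv_mult_perm:
  fixes \<alpha> :: real
  assumes irr: "\<alpha> \<notin> \<rat>" and cop: "coprime p (int q)"
    and pos: "0 < of_int p - real q * \<alpha>" and small: "real q * (of_int p - real q * \<alpha>) < 1"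
  shows "frac_perm \<alpha> q = inv' (mult_perm p q)"
proof -
  note perm = mult_perm_permutes[OF cop]
  let ?s = "inv' (mult_perm p q)"
  have s: "?s permutes {1..q}" using permutes_inv[OF perm] .
  have rs: "mult_perm p q (?s i) = i" for i using permutes_inverses(1)[OF perm] .
  have range: "?s i \<in> {1..q}" if "i \<in> {1..q}" for i using permutes_in_image[OF s] that by blast
  have "orders_frac_parts \<alpha> q ?s"
    unfolding orders_frac_parts_def
  proof (intro conjI ballI impI)
    show "?s permutes {1..q}" by (fact s)
    fix i assume i: "i \<in> {1..q}"
    then show "0 < frac (real (?s i) * \<alpha>)"
      using range[OF i] by (intro frac_mult_irrational_pos[OF irr]) simp
    show "frac (real (?s i) * \<alpha>) < 1" by (rule frac_lt_1)
    fix j assume j: "j \<in> {1..q}" "i < j"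
    have "real q * frac (real (?s i) * \<alpha>) < real i"
      using frac_between_multiples(2)[OF pos small range[OF i]] by (simp add: rs)
    also have "real i \<le> real j - 1" using j(2) by simp
    also have "\<dots> < real q * frac (real (?s j) * \<alpha>)"
      using frac_between_multiples(1)[OF pos small range[OF j(1)]] by (simp add: rs)
    finally show "frac (real (?s i) * \<alpha>) < frac (real (?s j) * \<alpha>)"
      using mult_less_cancel_left_pos[of "real q"] i by simp
  qed
  then show ?thesis
    unfolding frac_perm_def by (intro the1_equality[OF ex1_orders_frac_parts[OF irr]])
qed

lemma ord_frac_perm_le_totient:
  fixes \<alpha> :: real
  assumes irr: "\<alpha> \<notin> \<rat>" and cop: "coprime p (int q)" and q: "0 < q"
    and pos: "0 < of_int p - real q * \<alpha>" and small: "real q * (of_int p - real q * \<alpha>) < 1"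
  shows "group.ord (sym_group q) (frac_perm \<alpha> q) \<le> totient q"
proof -
  note perm = mult_perm_permutes[OF cop]
  have "inv' (mult_perm p q) ^^ totient q = inv' (mult_perm p q ^^ totient q)"
    using inv_fn[OF permutes_bij[OF perm]] by simp
  also have "\<dots> = id" by (simp add: funpow_totient_mult_perm[OF cop] inv_id)
  finally have "inv' (mult_perm p q) ^^ totient q = id" .
  moreover have "0 < totient q" using q by simp
  ultimately have "(LEAST t. 0 < t \<and> inv' (mult_perm p q) ^^ t = id) \<le> totient q"
    by (intro Least_le) simp
  then show ?thesis
    unfolding frac_perm_eq_inv_mult_perm[OF irr cop pos small]
    by (simp add: sym_group_ord_eq_Least[OF permutes_inv[OF perm]])
qed

theorem theorem1p2:
  fixes \<alpha> :: real
  assumes "\<alpha> \<notin> \<rat>"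
  shows "infinite {n :: nat. n > 0 \<and> group.ord (sym_group n) (frac_perm \<alpha> n) < n}"
  unfolding infinite_nat_iff_unbounded_le
proof
  fix N :: nat
  obtain p :: int and q :: nat where q: "0 < q" "max N 2 \<le> q" and pq: "coprime p (int q)"
    "0 < of_int p - real q * \<alpha>" "real q * (of_int p - real q * \<alpha>) < 1"
    using good_approximation_from_above[OF assms, of "max N 2"] by blast
  have "group.ord (sym_group q) (frac_perm \<alpha> q) \<le> totient q"
    using ord_frac_perm_le_totient[OF assms pq(1) q(1) pq(2,3)] .
  also have "totient q < q" using q by (intro totient_less) simp
  finally show "\<exists>n\<ge>N. n \<in> {n. n > 0 \<and> group.ord (sym_group n) (frac_perm \<alpha> n) < n}"
    using q by auto
qed

end
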